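(* Let $A,B\in\mathbb{R}_\infty^{m\times n}$ be two matrices and let $S\subseteq\{1,\dots,n\}$ be any subset. (I) Exactly one of the following two statements is true: 1. There is a solution $\vec x\in\mathbb{R}_\infty^n$ to $A\odot\vec x\le B\odot\vec x$ with finite coordinates $x_i$ for all $i\in S$. 2. There is a solution $\vec y\in\mathbb{R}_\infty^m$ to $B^T\odot\vec y<A^T\odot\vec y$ such that for some $i\in S$ the $i$-th coordinate of the vector $B^T\odot\vec y$ is finite. (II) Exactly one of the following two statements is true: 1. There is a solution $\vec x\in\mathbb{R}_\infty^n$ to $A\odot\vec x\le B\odot\vec x$ such that for some $i\in S$ the coordinate $x_i$ is finite. 2. There is a solution $\vec y\in\mathbb{R}_\infty^m$ to $B^T\odot\vec y<A^T\odot\vec y$ such that the $i$-th coordinates of the vector $B^T\odot\vec y$ are finite for all $i\in S$.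
   Context: $\mathbb{R}_\infty=\mathbb{R}\cup\{+\infty\}$. For a matrix $A=(a_{ij})\in\mathbb{R}_\infty^{m\times n}$ and $\vec x\in\mathbb{R}_\infty^n$, $A\odot\vec x$ is the vector in $\mathbb{R}_\infty^m$ with $i$-th coordinate $\min_j(a_{ij}+x_j)$. Inequalities between vectors are componentwise. Convention for strict inequalities: $\vec y$ is a solution of $C\odot\vec y<D\odot\vec y$ if for each row, either both sides are equal to $\infty$, or the strict inequality holds (i.e. "$\infty<\infty$" is allowed). *)

theory Defs
  imports "HOL-Analysis.Analysis"
begin

text \<open>
  The min-plus semiring is carried by \<open>\<real> \<union> {\<infinity>}\<close>, here a subset of \<^typ>\<open>ereal\<close>,
  which additionally contains \<open>-\<infinity>\<close>. Vectors and matrices are therefore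
  restricted to entries in this subset explicitly.
\<close>

definition Rinf :: "ereal set" where
  "Rinf = insert \<infinity> (range ereal)"

definition Rinf_vec :: "(ereal ^ 'n::finite) set" where
  "Rinf_vec = {x. \<forall>i. x $ i \<in> Rinf}"

definition Rinf_mat :: "(ereal ^ 'n::finite ^ 'm::finite) set" where
  "Rinf_mat = {A. \<forall>i j. A $ i $ j \<in> Rinf}"

definition trop_mult_vec ::
    "ereal ^ 'n::finite ^ 'm::finite \<Rightarrow> ereal ^ 'n \<Rightarrow> ereal ^ 'm" (infixr "\<odot>" 75) where
  "A \<odot> x = (\<chi> i. Min (range (\<lambda>j. A $ i $ j + x $ j)))"

text \<open>
  Strict inequality of vectors, with \<open>\<infinity> < \<infinity>\<close> allowed in each coordinate. This is not
  the order-theoretic \<open><\<close> that the library defines on vectors; the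
  library's \<open>\<le>\<close> on vectors is componentwise and is used as it is.
\<close>

definition trop_less :: "ereal ^ 'm::finite \<Rightarrow> ereal ^ 'm \<Rightarrow> bool" (infix "\<prec>" 50) where
  "u \<prec> v \<longleftrightarrow> (\<forall>i. (u $ i = \<infinity> \<and> v $ i = \<infinity>) \<or> u $ i < v $ i)"

end

theory Submission
  imports Defs
begin

text \<open>
  Both alternatives follow from one fact: there are solutions \<open>x\<close> of \<open>A \<odot> x \<le> B \<odot> x\<close> and
  \<open>y\<close> of \<open>B\<^sup>T \<odot> y \<prec> A\<^sup>T \<odot> y\<close> such that in every coordinate \<open>j\<close> exactly one of \<open>x\<^sub>j\<close>
  and \<open>(B\<^sup>T \<odot> y)\<^sub>j\<close> is finite. No pair of solutions can have both finite
  (\<open>no_common_finite_coordinate\<close>), by a min-plus version of weak duality: in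
  \<open>min\<^sub>j (x\<^sub>j + (B\<^sup>T \<odot> y)\<^sub>j) = min\<^sub>i (y\<^sub>i + (B \<odot> x)\<^sub>i) \<ge> min\<^sub>i (y\<^sub>i + (A \<odot> x)\<^sub>i)
  = min\<^sub>j (x\<^sub>j + (A\<^sup>T \<odot> y)\<^sub>j)\<close> the last minimum would have to exceed the first. So the content
  is the existence of one pair covering every coordinate (\<open>ex_strictly_complementary\<close>).

  The system \<open>A \<odot> x \<le> B \<odot> x\<close> says \<open>x \<ge> f x\<close>, where
  \<open>(f x)\<^sub>j = max\<^sub>i ((A \<odot> x)\<^sub>i - b\<^sub>i\<^sub>j)\<close> over the \<open>i\<close> with \<open>b\<^sub>i\<^sub>j\<close> finite. The map
  \<open>g = max id f\<close> is monotone, commutes with adding a constant to all coordinates, and its orbit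
  \<open>0 \<le> g 0 \<le> g (g 0) \<le> \<dots>\<close> increases to a solution \<open>x\<close> in \<open>\<real> \<union> {\<infinity>}\<close>
  (\<open>sup_ascent_row\<close>). Let \<open>U\<close> be the set of coordinates in which the orbit is unbounded, that
  is, \<open>x\<^sub>j = \<infinity>\<close>. Once the orbit has grown by at least one on \<open>U\<close>, finitely many of its members
  combine into a single real vector \<open>w\<close> with \<open>w < g w\<close>, hence \<open>w < f w\<close>, on \<open>U\<close>
  (\<open>ex_strict_subfixpoint\<close>). Such a vector is a dual solution in disguise: put
  \<open>y\<^sub>i = - (A \<odot> w)\<^sub>i\<close>, where a large real number stands in for \<open>(A \<odot> w)\<^sub>i\<close>, here and in \<open>f\<close>,
  if row \<open>i\<close> of \<open>A\<close> has no finite entry. Then \<open>(B\<^sup>T \<odot> y)\<^sub>j = - (f w)\<^sub>j < - w\<^sub>j\<close>, whereas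
  \<open>a\<^sub>i\<^sub>j + y\<^sub>i \<ge> - w\<^sub>j\<close> for every \<open>i\<close>. To get \<open>\<infinity>\<close> on both sides outside \<open>U\<close>, only rows
  of \<open>A\<close> whose finite entries all lie in \<open>U\<close> keep a finite \<open>y\<^sub>i\<close>; the other rows cannot be the
  ones that push the coordinates of \<open>U\<close> up, provided \<open>w\<close> is large on \<open>U\<close>.
\<close>

section \<open>Min-plus products\<close>

lemma Rinf_iff: "a \<in> Rinf \<longleftrightarrow> a \<noteq> -\<infinity>"
  by (cases a) (auto simp: Rinf_def)

lemma trop_mult_vec_le: "(A \<odot> x) $ i \<le> A $ i $ j + x $ j"
  unfolding trop_mult_vec_def by simp

lemma trop_mult_vec_attained: "\<exists>j. (A \<odot> x) $ i = A $ i $ j + x $ j"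
proof -
  have "Min (range (\<lambda>j. A $ i $ j + x $ j)) \<in> range (\<lambda>j. A $ i $ j + x $ j)"
    by (rule Min_in) auto
  then obtain j where "Min (range (\<lambda>j. A $ i $ j + x $ j)) = A $ i $ j + x $ j"
    by (rule rangeE)
  then show ?thesis
    unfolding trop_mult_vec_def by (intro exI[of _ j]) simp
qed

text \<open>
  The infinite entries prevent a subtraction in the duality chain, so the argument descends
  instead: from a column \<open>l\<close> minimizing \<open>x\<^sub>l + (B\<^sup>T \<odot> y)\<^sub>l\<close>, the row attaining
  \<open>(B\<^sup>T \<odot> y)\<^sub>l\<close> and then the column attaining \<open>A \<odot> x\<close> in that row give a column with a
  strictly smaller sum.
\<close>

lemma no_common_finite_coordinate:
  assumes AB: "A \<in> Rinf_mat" "B \<in> Rinf_mat" and x: "x \<in> Rinf_vec" and y: "y \<in> Rinf_vec"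
    and le: "A \<odot> x \<le> B \<odot> x" and less: "transpose B \<odot> y \<prec> transpose A \<odot> y"
  shows "\<bar>x $ j\<bar> = \<infinity> \<or> \<bar>(transpose B \<odot> y) $ j\<bar> = \<infinity>"
proof (rule ccontr)
  assume fin: "\<not> ?thesis"
  define p where "p = (\<lambda>j. x $ j + (transpose B \<odot> y) $ j)"
  have "Min (range p) \<in> range p"
    by (rule Min_in) auto
  then obtain l where "Min (range p) = p l"
    by (rule rangeE)
  then have l: "p l \<le> p k" for k
    by (metis Min_le finite finite_imageI rangeI)
  have "p j < \<infinity>"
    using fin unfolding p_def by (cases "x $ j"; cases "(transpose B \<odot> y) $ j") auto
  with l have pl: "p l < \<infinity>"
    by (meson order_le_less_trans)
  obtain i where i: "(transpose B \<odot> y) $ l = B $ i $ l + y $ i"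
    using trop_mult_vec_attained[of "transpose B" y l] by (auto simp: transpose_def)
  obtain k where k: "(A \<odot> x) $ i = A $ i $ k + x $ k"
    using trop_mult_vec_attained by blast
  have "A $ i $ k + x $ k \<le> (B \<odot> x) $ i"
    using le k by (metis less_eq_vec_def)
  also have "\<dots> \<le> B $ i $ l + x $ l"
    by (rule trop_mult_vec_le)
  finally have le1: "A $ i $ k + x $ k \<le> B $ i $ l + x $ l" .
  have le2: "(transpose A \<odot> y) $ k \<le> A $ i $ k + y $ i"
    using trop_mult_vec_le[of "transpose A" y k i] by (simp add: transpose_def)
  have "A $ i $ k \<noteq> -\<infinity>" "B $ i $ l \<noteq> -\<infinity>" "x $ k \<noteq> -\<infinity>" "x $ l \<noteq> -\<infinity>" "y $ i \<noteq> -\<infinity>"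
    using AB x y by (auto simp: Rinf_mat_def Rinf_vec_def Rinf_iff)
  with le1 pl i obtain a b xk xl r where
    r: "A $ i $ k = ereal a" "B $ i $ l = ereal b" "x $ k = ereal xk" "x $ l = ereal xl" "y $ i = ereal r"
    unfolding p_def
    by (cases "A $ i $ k"; cases "B $ i $ l"; cases "x $ k"; cases "x $ l"; cases "y $ i") auto
  have "(transpose B \<odot> y) $ k < A $ i $ k + y $ i"
    using less le2 r unfolding trop_less_def by (metis PInfty_neq_ereal(1) ereal_infty_less_eq(1) order_less_le_trans plus_ereal.simps(1))
  then have "p k < p l"
    unfolding p_def using le1 i r by (cases "(transpose B \<odot> y) $ k") auto
  with l[of k] show False
    by simp
qed

section \<open>Vectors that a monotone homogeneous map pushes up\<close>

lemma funpow_inflationary_mono: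
  fixes g :: "('n \<Rightarrow> real) \<Rightarrow> 'n \<Rightarrow> real"
  assumes "\<And>x. x \<le> g x" "s \<le> t"
  shows "(g ^^ s) z \<le> (g ^^ t) z"
  using assms(2) by (induction t rule: dec_induct) (auto intro: order_trans assms(1))

text \<open>
  With \<open>\<epsilon> = 1 / (n + 1)\<close>, the witness is the maximum over \<open>t \<le> n\<close> of \<open>g\<^sup>t z - t \<epsilon>\<close>. Applying
  \<open>g\<close> shifts this family by one index and adds \<open>\<epsilon>\<close>; the shifted family misses only the member
  \<open>t = 0\<close>, which on \<open>U\<close> is dominated by the new member \<open>t = n + 1\<close> because the orbit has
  gained \<open>(n + 1) \<epsilon> = 1\<close> there. The two bounds keep the witness close to the orbit, so that it is
  large where the orbit is large and small where the orbit is bounded.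
\<close>

lemma ex_strict_subfixpoint:
  fixes g :: "('n \<Rightarrow> real) \<Rightarrow> 'n \<Rightarrow> real"
  assumes mono: "mono g" and hom: "\<And>x c. g (\<lambda>j. x j + c) = (\<lambda>j. g x j + c)"
    and infl: "\<And>x. x \<le> g x"
    and gain: "\<And>j. j \<in> U \<Longrightarrow> z j + 1 \<le> (g ^^ Suc n) z j"
  obtains x where "\<And>j. (g ^^ n) z j - 1 \<le> x j" "x \<le> (g ^^ n) z" "\<And>j. j \<in> U \<Longrightarrow> x j < g x j"
proof -
  define e where "e = 1 / real (Suc n)"
  have e: "e > 0" "real (Suc n) * e = 1"
    unfolding e_def by auto
  define u where "u = (\<lambda>t j. (g ^^ t) z j - real t * e)"
  define x where "x = (\<lambda>j. Max ((\<lambda>t. u t j) ` {..n}))"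
  have ux: "u t j \<le> x j" if "t \<le> n" for t j
    unfolding x_def using that by auto
  have xu: "\<exists>t\<le>n. x j = u t j" for j
  proof -
    have "x j \<in> (\<lambda>t. u t j) ` {..n}"
      unfolding x_def by (rule Max_in) auto
    then show ?thesis by auto
  qed
  have step: "u (Suc t) j + e \<le> g x j" if "t \<le> n" for t j
  proof -
    have "g (u t) = (\<lambda>j. (g ^^ Suc t) z j + - (real t * e))"
      unfolding u_def using hom[of "(g ^^ t) z" "- (real t * e)"] by simp
    then have "g (u t) j = u (Suc t) j + e"
      unfolding u_def by (simp add: algebra_simps)
    moreover have "g (u t) \<le> g x"
      by (rule monoD[OF mono]) (simp add: le_fun_def ux that)
    ultimately show ?thesis
      by (metis le_fun_def)
  qed
  show thesis
  proof (rule that)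
    fix j
    have "real n * e \<le> 1"
      unfolding e_def by simp
    then show "(g ^^ n) z j - 1 \<le> x j"
      using ux[of n j] unfolding u_def by simp
  next
    show "x \<le> (g ^^ n) z"
    proof (rule le_funI)
      fix j
      obtain t where "t \<le> n" and t: "x j = u t j" using xu by blast
      then have "(g ^^ t) z j \<le> (g ^^ n) z j"
        using funpow_inflationary_mono[where g = g] infl by (metis le_fun_def)
      then show "x j \<le> (g ^^ n) z j"
        using e(1) unfolding t u_def by (smt (verit) mult_nonneg_nonneg of_nat_0_le_iff)
    qed
  next
    fix j assume j: "j \<in> U"
    obtain t where "t \<le> n" and t: "x j = u t j" using xu by blast
    have "u t j + e \<le> g x j"
    proof (cases t)
      case 0
      have "u 0 j \<le> u (Suc n) j"
        using gain[OF j] e(2) unfolding u_def by simp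
      then show ?thesis
        using step[of n j] 0 by simp
    next
      case (Suc s)
      then show ?thesis
        using step[of s j] \<open>t \<le> n\<close> by simp
    qed
    then show "x j < g x j"
      using t e(1) by simp
  qed
qed

section \<open>The ascent map of a two-sided min-plus system\<close>

text \<open>
  On a row of \<open>A\<close> with a finite entry this is \<open>(A \<odot> x)\<^sub>i\<close>. On a row without one, where
  \<open>(A \<odot> x)\<^sub>i = \<infinity>\<close>, a real value is chosen that exceeds all finite \<open>b\<^sub>i\<^sub>j + x\<^sub>j\<close> by at least one: this
  keeps the ascent map real-valued and still drives every \<open>x\<^sub>j\<close> with \<open>b\<^sub>i\<^sub>j\<close> finite to infinity.
  Infinite entries of \<open>B\<close> enter that maximum as \<open>0\<close>, which does no harm, since only a lower
  bound, monotonicity and homogeneity of the value matter.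
\<close>

definition row_value :: "ereal ^ 'n::finite ^ 'm::finite \<Rightarrow> ereal ^ 'n ^ 'm \<Rightarrow> ('n \<Rightarrow> real) \<Rightarrow> 'm \<Rightarrow> real" where
  "row_value A B x i =
    (if \<forall>k. A $ i $ k = \<infinity> then Max (range (\<lambda>k. real_of_ereal (B $ i $ k) + x k)) + 1
     else Min ((\<lambda>k. real_of_ereal (A $ i $ k) + x k) ` {k. A $ i $ k \<noteq> \<infinity>}))"

text \<open>
  Including \<open>x j\<close> in the maximum makes the map inflationary, so that its orbits increase, and
  covers the columns of \<open>B\<close> without finite entries.
\<close>

definition ascent :: "ereal ^ 'n::finite ^ 'm::finite \<Rightarrow> ereal ^ 'n ^ 'm \<Rightarrow> ('n \<Rightarrow> real) \<Rightarrow> 'n \<Rightarrow> real" where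
  "ascent A B x j =
    Max (insert (x j) ((\<lambda>i. row_value A B x i - real_of_ereal (B $ i $ j)) ` {i. B $ i $ j \<noteq> \<infinity>}))"

lemma row_value_le:
  "A $ i $ k \<noteq> \<infinity> \<Longrightarrow> row_value A B x i \<le> real_of_ereal (A $ i $ k) + x k"
  unfolding row_value_def by auto

lemma row_value_attained:
  assumes "A $ i $ l \<noteq> \<infinity>"
  obtains k where "A $ i $ k \<noteq> \<infinity>" "row_value A B x i = real_of_ereal (A $ i $ k) + x k"
proof -
  have "row_value A B x i = Min ((\<lambda>k. real_of_ereal (A $ i $ k) + x k) ` {k. A $ i $ k \<noteq> \<infinity>})"
    using assms unfolding row_value_def by auto
  also have "\<dots> \<in> (\<lambda>k. real_of_ereal (A $ i $ k) + x k) ` {k. A $ i $ k \<noteq> \<infinity>}"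
    by (rule Min_in) (use assms in auto)
  finally show thesis
    using that by auto
qed

lemma row_value_infinite_row:
  assumes "\<And>k. A $ i $ k = \<infinity>"
  shows "real_of_ereal (B $ i $ j) + x j + 1 \<le> row_value A B x i"
  using assms unfolding row_value_def by simp

lemma row_value_mono:
  assumes "x \<le> x'"
  shows "row_value A B x i \<le> row_value A B x' i"
proof (cases "\<forall>k. A $ i $ k = \<infinity>")
  case True
  have "Max (range (\<lambda>k. real_of_ereal (B $ i $ k) + x k))
    \<le> Max (range (\<lambda>k. real_of_ereal (B $ i $ k) + x' k))"
    using assms by (subst Max_le_iff) (auto simp: le_fun_def Max_ge_iff intro!: add_left_mono)
  with True show ?thesis
    unfolding row_value_def by simp
next
  case False
  then obtain l where "A $ i $ l \<noteq> \<infinity>" by auto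
  then obtain k where k: "A $ i $ k \<noteq> \<infinity>" "row_value A B x' i = real_of_ereal (A $ i $ k) + x' k"
    by (rule row_value_attained)
  then show ?thesis
    using row_value_le[OF k(1), of B x] assms by (simp add: le_fun_def) (smt (verit))
qed

lemma row_value_add: "row_value A B (\<lambda>j. x j + c) i = row_value A B x i + c"
proof -
  have "row_value A B x i + c \<le> row_value A B (\<lambda>j. x j + c) i" for x c
  proof (cases "\<forall>k. A $ i $ k = \<infinity>")
    case True
    define M where "M = Max (range (\<lambda>k. real_of_ereal (B $ i $ k) + x k))"
    have "M \<in> range (\<lambda>k. real_of_ereal (B $ i $ k) + x k)"
      unfolding M_def by (rule Max_in) auto
    then obtain k where "M = real_of_ereal (B $ i $ k) + x k" by auto
    then have "M + c \<le> Max (range (\<lambda>k. real_of_ereal (B $ i $ k) + (x k + c)))"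
      by (auto intro!: Max_ge)
    with True show ?thesis
      unfolding row_value_def M_def by simp
  next
    case False
    then obtain l where "A $ i $ l \<noteq> \<infinity>" by auto
    then obtain k where k: "A $ i $ k \<noteq> \<infinity>"
      "row_value A B (\<lambda>j. x j + c) i = real_of_ereal (A $ i $ k) + (x k + c)"
      by (rule row_value_attained)
    then show ?thesis
      using row_value_le[OF k(1), of B x] by simp
  qed
  from this[of x c] this[of "\<lambda>j. x j + c" "- c"] show ?thesis
    by simp
qed

lemma ascent_ge: "B $ i $ j \<noteq> \<infinity> \<Longrightarrow> row_value A B x i - real_of_ereal (B $ i $ j) \<le> ascent A B x j"
  unfolding ascent_def by (intro Max_ge) auto

lemma ascent_inflationary: "x \<le> ascent A B x"
  unfolding ascent_def by (auto simp: le_fun_def intro!: Max_ge)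

lemma ascent_cases:
  obtains "ascent A B x j = x j"
  | i where "B $ i $ j \<noteq> \<infinity>" "ascent A B x j = row_value A B x i - real_of_ereal (B $ i $ j)"
proof -
  have "ascent A B x j \<in>
    insert (x j) ((\<lambda>i. row_value A B x i - real_of_ereal (B $ i $ j)) ` {i. B $ i $ j \<noteq> \<infinity>})"
    unfolding ascent_def by (rule Max_in) auto
  then show thesis
    using that by auto
qed

lemma ascent_mono:
  fixes A B :: "ereal ^ 'n::finite ^ 'm::finite"
  shows "mono (ascent A B)"
proof (intro monoI le_funI)
  fix x x' :: "'n \<Rightarrow> real" and j
  assume le: "x \<le> x'"
  show "ascent A B x j \<le> ascent A B x' j"
  proof (cases rule: ascent_cases[of A B x j])
    case 1
    then show ?thesis
      using le ascent_inflationary[of x' A B] by (metis le_fun_def order_trans)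
  next
    case (2 i)
    then show ?thesis
      using ascent_ge[OF 2(1), of A x'] row_value_mono[OF le, of A B i] by simp
  qed
qed

lemma ascent_add: "ascent A B (\<lambda>j. x j + c) = (\<lambda>j. ascent A B x j + c)"
proof
  fix j
  have "ascent A B x j + c \<le> ascent A B (\<lambda>j. x j + c) j" for x c
  proof (cases rule: ascent_cases[of A B x j])
    case 1
    then show ?thesis
      using ascent_inflationary[of "\<lambda>j. x j + c" A B] by (metis le_fun_def)
  next
    case (2 i)
    then show ?thesis
      using ascent_ge[OF 2(1), of A "\<lambda>j. x j + c"] by (simp add: row_value_add)
  qed
  from this[of x c] this[of "\<lambda>j. x j + c" "- c"]
  show "ascent A B (\<lambda>j. x j + c) j = ascent A B x j + c"
    by simp
qed

section \<open>A strictly complementary pair of solutions\<close>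

text \<open>
  For the supremum of the orbit, \<open>(A \<odot> x)\<^sub>i\<close> is at most each finite term of the minimum
  \<open>(B \<odot> x)\<^sub>i\<close>; this makes it a solution. At each time \<open>t\<close> some column \<open>k\<close> witnesses the
  inequality, and the witness may change with \<open>t\<close>; but there are finitely many columns and the
  orbit increases, so one column serves for all \<open>t\<close> and its supremum is finite. That \<open>a\<^sub>i\<^sub>k\<close> and
  \<open>x\<^sub>k\<close> are finite is recorded because it excludes row \<open>i\<close> from the support of the dual vector.
\<close>

lemma sup_ascent_row:
  fixes A B :: "ereal ^ 'n::finite ^ 'm::finite"
  assumes AB: "A \<in> Rinf_mat" "B \<in> Rinf_mat"
    and X_def: "X = (\<lambda>j. SUP t. ereal ((ascent A B ^^ t) (\<lambda>_. 0) j))"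
    and b: "B $ i $ j \<noteq> \<infinity>" and j: "X j \<noteq> \<infinity>"
  shows "\<exists>k. A $ i $ k \<noteq> \<infinity> \<and> X k \<noteq> \<infinity> \<and> A $ i $ k + X k \<le> B $ i $ j + X j"
proof -
  define v where "v = (\<lambda>t. (ascent A B ^^ t) (\<lambda>_. 0))"
  have upper: "ereal (v t k) \<le> X k" for t k
    unfolding X_def v_def by (rule SUP_upper) auto
  have v_mono: "v s k \<le> v t k" if "s \<le> t" for s t k
    using funpow_inflationary_mono[of "ascent A B", OF ascent_inflationary that]
    unfolding v_def le_fun_def by blast
  obtain \<xi> where \<xi>: "X j = ereal \<xi>"
    using j upper[of 0 j] by (cases "X j") auto
  obtain \<beta> where \<beta>: "B $ i $ j = ereal \<beta>"
    using b AB(2) by (cases "B $ i $ j") (auto simp: Rinf_mat_def Rinf_iff)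
  have row: "row_value A B (v t) i \<le> \<beta> + \<xi>" for t
    using ascent_ge[OF b, of A "v t"] upper[of "Suc t" j] \<beta> \<xi> unfolding v_def by simp
  \<comment> \<open>A row of infinities would make coordinate \<open>j\<close> grow by one in every step, beyond \<open>\<xi>\<close>.\<close>
  have "\<exists>l. A $ i $ l \<noteq> \<infinity>"
  proof (rule ccontr)
    assume "\<not> ?thesis"
    then have "\<beta> + v t j + 1 \<le> row_value A B (v t) i" for t
      using row_value_infinite_row[of A i B j "v t"] \<beta> by simp
    then have "v t j \<le> \<xi> - 1" for t
      using row[of t] by (smt (verit))
    then have "X j \<le> ereal (\<xi> - 1)"
      unfolding X_def v_def by (intro SUP_least) simp
    with \<xi> show False by simp
  qed
  then obtain l where l: "A $ i $ l \<noteq> \<infinity>" ..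
  have "\<exists>k. A $ i $ k \<noteq> \<infinity> \<and> (\<forall>t. real_of_ereal (A $ i $ k) + v t k \<le> \<beta> + \<xi>)"
  proof (rule ccontr)
    assume "\<not> ?thesis"
    then obtain \<tau> where \<tau>: "A $ i $ k \<noteq> \<infinity> \<Longrightarrow> \<beta> + \<xi> < real_of_ereal (A $ i $ k) + v (\<tau> k) k" for k
      by (metis not_le)
    \<comment> \<open>By time \<open>T\<close> every column has failed, and a failure persists since the orbit increases.\<close>
    define T where "T = Max (range \<tau>)"
    obtain k where k: "A $ i $ k \<noteq> \<infinity>" "row_value A B (v T) i = real_of_ereal (A $ i $ k) + v T k"
      using l by (rule row_value_attained)
    have "v (\<tau> k) k \<le> v T k"
      by (rule v_mono) (simp add: T_def)
    with \<tau>[OF k(1)] k(2) row[of T] show False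
      by simp
  qed
  then obtain k where k: "A $ i $ k \<noteq> \<infinity>" "\<And>t. real_of_ereal (A $ i $ k) + v t k \<le> \<beta> + \<xi>"
    by blast
  obtain \<alpha> where \<alpha>: "A $ i $ k = ereal \<alpha>"
    using k(1) AB(1) by (cases "A $ i $ k") (auto simp: Rinf_mat_def Rinf_iff)
  have "v t k \<le> \<beta> + \<xi> - \<alpha>" for t
    using k(2)[of t] \<alpha> by simp
  then have "X k \<le> ereal (\<beta> + \<xi> - \<alpha>)"
    unfolding X_def v_def by (intro SUP_least) simp
  then show ?thesis
    using k(1) \<alpha> \<beta> \<xi> upper[of 0 k] by (intro exI[of _ k]) (cases "X k"; auto)
qed

text \<open>
  Strict complementarity: together with \<open>no_common_finite_coordinate\<close>, the finite coordinates of
  \<open>x\<close> and of \<open>B\<^sup>T \<odot> y\<close> partition the set of columns, whence \<open>x\<close> has the largest possible finite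
  support among all solutions, and so does \<open>B\<^sup>T \<odot> y\<close>.
\<close>

lemma ex_strictly_complementary:
  fixes A B :: "ereal ^ 'n::finite ^ 'm::finite"
  assumes AB: "A \<in> Rinf_mat" "B \<in> Rinf_mat"
  obtains x y where "x \<in> Rinf_vec" "y \<in> Rinf_vec" "A \<odot> x \<le> B \<odot> x"
    "transpose B \<odot> y \<prec> transpose A \<odot> y"
    "\<And>j. \<bar>x $ j\<bar> = \<infinity> \<Longrightarrow> \<bar>(transpose B \<odot> y) $ j\<bar> \<noteq> \<infinity>"
proof -
  define v where "v = (\<lambda>t. (ascent A B ^^ t) (\<lambda>_. 0))"
  define X where "X = (\<lambda>j. SUP t. ereal (v t j))"
  note X_row = sup_ascent_row[OF AB, of X, OF X_def[unfolded v_def]]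
  define U where "U = {j. X j = \<infinity>}"
  have upper: "ereal (v t k) \<le> X k" for t k
    unfolding X_def by (rule SUP_upper) auto
  have v_mono: "v s k \<le> v t k" if "s \<le> t" for s t k
    using funpow_inflationary_mono[of "ascent A B", OF ascent_inflationary that]
    unfolding v_def le_fun_def by blast
  have X_fin: "X j \<noteq> -\<infinity>" for j
    using upper[of 0 j] by auto
  have A_real: "A $ i $ j \<noteq> \<infinity> \<Longrightarrow> A $ i $ j = ereal (real_of_ereal (A $ i $ j))" for i j
    using AB by (cases "A $ i $ j") (auto simp: Rinf_mat_def Rinf_iff)
  have B_real: "B $ i $ j \<noteq> \<infinity> \<Longrightarrow> B $ i $ j = ereal (real_of_ereal (B $ i $ j))" for i j
    using AB by (cases "B $ i $ j") (auto simp: Rinf_mat_def Rinf_iff)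

  \<comment> \<open>\<open>C\<close> bounds what a row with a finite entry outside \<open>U\<close> can ever demand of a coordinate;
    waiting until the orbit reaches \<open>C + 1\<close> on \<open>U\<close> rules such rows out below. The
    maximum with \<open>0\<close> gives the gain of one that \<open>ex_strict_subfixpoint\<close> needs.\<close>
  define C where "C = Max (range (\<lambda>(i, j, k).
    real_of_ereal (A $ i $ k) + real_of_ereal (X k) - real_of_ereal (B $ i $ j)))"
  have C: "real_of_ereal (A $ i $ k) + real_of_ereal (X k) - real_of_ereal (B $ i $ j) \<le> C" for i j k
    unfolding C_def by (rule Max_ge) (auto intro!: image_eqI[of _ _ "(i, j, k)"])
  have "\<exists>t. j \<in> U \<longrightarrow> max C 0 + 1 \<le> v t j" for j
  proof (cases "j \<in> U")
    case True
    then have "ereal (max C 0 + 1) < (SUP t. ereal (v t j))"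
      unfolding U_def X_def by simp
    then show ?thesis
      by (auto simp: less_SUP_iff intro: less_imp_le)
  qed auto
  then obtain \<tau> where \<tau>: "j \<in> U \<Longrightarrow> max C 0 + 1 \<le> v (\<tau> j) j" for j
    by metis
  define n where "n = Max (range \<tau>)"
  have n: "max C 0 + 1 \<le> v n j" if "j \<in> U" for j
    using \<tau>[OF that] v_mono[of "\<tau> j" n j] by (simp add: n_def)
  have gain: "0 + 1 \<le> (ascent A B ^^ Suc n) (\<lambda>_. 0) j" if "j \<in> U" for j
    using n[OF that] v_mono[of n "Suc n" j] by (simp add: v_def)
  obtain w where w: "\<And>j. v n j - 1 \<le> w j" "w \<le> v n" "\<And>j. j \<in> U \<Longrightarrow> w j < ascent A B w j"
    using ex_strict_subfixpoint[OF ascent_mono ascent_add ascent_inflationary gain] unfolding v_def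
    by blast

  define W where "W = {i. \<forall>k. A $ i $ k \<noteq> \<infinity> \<longrightarrow> k \<in> U}"
  define x :: "ereal ^ 'n" where "x = (\<chi> j. X j)"
  define y :: "ereal ^ 'm" where "y = (\<chi> i. if i \<in> W then ereal (- row_value A B w i) else \<infinity>)"
  have xv: "x \<in> Rinf_vec" and yv: "y \<in> Rinf_vec"
    using X_fin by (auto simp: x_def y_def Rinf_vec_def Rinf_iff)
  have sol: "A \<odot> x \<le> B \<odot> x"
    unfolding less_eq_vec_def
  proof
    fix i
    obtain j where j: "(B \<odot> x) $ i = B $ i $ j + X j"
      using trop_mult_vec_attained[of B x i] by (auto simp: x_def)
    show "(A \<odot> x) $ i \<le> (B \<odot> x) $ i"
    proof (cases "B $ i $ j = \<infinity> \<or> X j = \<infinity>")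
      case True
      then show ?thesis by (auto simp: j)
    next
      case False
      then obtain k where "A $ i $ k + X k \<le> B $ i $ j + X j"
        using X_row[of i j] by auto
      then show ?thesis
        using trop_mult_vec_le[of A x i k] j by (simp add: x_def)
    qed
  qed
  have in_U: "(transpose B \<odot> y) $ j < ereal (- w j) \<and> ereal (- w j) \<le> (transpose A \<odot> y) $ j"
    if j: "j \<in> U" for j
  proof
    obtain i where i: "B $ i $ j \<noteq> \<infinity>" "ascent A B w j = row_value A B w i - real_of_ereal (B $ i $ j)"
      using w(3)[OF j] by (cases rule: ascent_cases[of A B w j]) auto
    \<comment> \<open>The row \<open>i\<close> that pushes \<open>w j\<close> up has all its finite entries in \<open>U\<close>: otherwise
      it pushes no higher than \<open>C\<close>, and \<open>w j\<close> is already there.\<close>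
    have "k \<in> U" if k: "A $ i $ k \<noteq> \<infinity>" for k
    proof (rule ccontr)
      assume "k \<notin> U"
      then have "ereal (v n k) \<le> ereal (real_of_ereal (X k))"
        using upper[of n k] X_fin[of k] unfolding U_def by (cases "X k") auto
      then have "w k \<le> real_of_ereal (X k)"
        using w(2) by (simp add: le_fun_def) (meson order_trans)
      then have "ascent A B w j \<le> C"
        using row_value_le[of A i k B w, OF k] C[of i k j] i(2) by simp
      with n[OF j] w(1)[of j] w(3)[OF j] show False
        by simp
    qed
    then have "i \<in> W"
      unfolding W_def by blast
    then have "B $ i $ j + y $ i = ereal (real_of_ereal (B $ i $ j) - row_value A B w i)"
      by (subst B_real[OF i(1)]) (simp add: y_def)
    also have "\<dots> < ereal (- w j)"
      using w(3)[OF j] i(2) by simp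
    finally show "(transpose B \<odot> y) $ j < ereal (- w j)"
      using trop_mult_vec_le[of "transpose B" y j i] by (simp add: transpose_def)
  next
    obtain i where i: "(transpose A \<odot> y) $ j = A $ i $ j + y $ i"
      using trop_mult_vec_attained[of "transpose A" y j] by (auto simp: transpose_def)
    show "ereal (- w j) \<le> (transpose A \<odot> y) $ j"
    proof (cases "A $ i $ j = \<infinity> \<or> i \<notin> W")
      case True
      then show ?thesis
        unfolding i by (auto simp: y_def)
    next
      case False
      then show ?thesis
        unfolding i using row_value_le[of A i j B w] by (subst A_real) (auto simp: y_def)
    qed
  qed
  have notin_U: "(transpose B \<odot> y) $ j = \<infinity> \<and> (transpose A \<odot> y) $ j = \<infinity>"
    if j: "j \<notin> U" for j
  proof
    have "B $ i $ j + y $ i = \<infinity>" for i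
      using X_row[of i j] j unfolding y_def W_def U_def by auto
    then show "(transpose B \<odot> y) $ j = \<infinity>"
      using trop_mult_vec_attained[of "transpose B" y j] by (auto simp: transpose_def)
    have "A $ i $ j + y $ i = \<infinity>" for i
      using j unfolding y_def W_def by auto
    then show "(transpose A \<odot> y) $ j = \<infinity>"
      using trop_mult_vec_attained[of "transpose A" y j] by (auto simp: transpose_def)
  qed
  show thesis
  proof (rule that[OF xv yv sol])
    show "transpose B \<odot> y \<prec> transpose A \<odot> y"
      unfolding trop_less_def using in_U notin_U by (meson order_less_le_trans)
  next
    fix j assume "\<bar>x $ j\<bar> = \<infinity>"
    then have j: "j \<in> U"
      using X_fin[of j] by (cases "X j") (auto simp: x_def U_def)
    obtain i where i: "(transpose B \<odot> y) $ j = B $ i $ j + y $ i"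
      using trop_mult_vec_attained[of "transpose B" y j] by (auto simp: transpose_def)
    have "B $ i $ j \<noteq> -\<infinity>" "y $ i \<noteq> -\<infinity>"
      using AB yv by (auto simp: Rinf_mat_def Rinf_vec_def Rinf_iff)
    then have "(transpose B \<odot> y) $ j \<noteq> -\<infinity>"
      using i by simp
    then show "\<bar>(transpose B \<odot> y) $ j\<bar> \<noteq> \<infinity>"
      using in_U[OF j] by auto
  qed
qed

theorem lemma12:
  fixes A B :: "ereal ^ 'n::finite ^ 'm::finite" and S :: "'n set"
  assumes "A \<in> Rinf_mat" and "B \<in> Rinf_mat"
  shows
    "((\<exists>x\<in>Rinf_vec. A \<odot> x \<le> B \<odot> x \<and> (\<forall>i\<in>S. \<bar>x $ i\<bar> \<noteq> \<infinity>))
      \<longleftrightarrow> \<not> (\<exists>y\<in>Rinf_vec. transpose B \<odot> y \<prec> transpose A \<odot> y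
               \<and> (\<exists>i\<in>S. \<bar>(transpose B \<odot> y) $ i\<bar> \<noteq> \<infinity>)))
     \<and>
     ((\<exists>x\<in>Rinf_vec. A \<odot> x \<le> B \<odot> x \<and> (\<exists>i\<in>S. \<bar>x $ i\<bar> \<noteq> \<infinity>))
      \<longleftrightarrow> \<not> (\<exists>y\<in>Rinf_vec. transpose B \<odot> y \<prec> transpose A \<odot> y
               \<and> (\<forall>i\<in>S. \<bar>(transpose B \<odot> y) $ i\<bar> \<noteq> \<infinity>)))"
proof -
  obtain x y where xy: "x \<in> Rinf_vec" "y \<in> Rinf_vec" "A \<odot> x \<le> B \<odot> x"
    "transpose B \<odot> y \<prec> transpose A \<odot> y"
    "\<And>j. \<bar>x $ j\<bar> = \<infinity> \<Longrightarrow> \<bar>(transpose B \<odot> y) $ j\<bar> \<noteq> \<infinity>"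
    using ex_strictly_complementary[OF assms] by blast
  have excl: "\<bar>x' $ j\<bar> = \<infinity> \<or> \<bar>(transpose B \<odot> y') $ j\<bar> = \<infinity>"
    if "x' \<in> Rinf_vec" "A \<odot> x' \<le> B \<odot> x'"
      "y' \<in> Rinf_vec" "transpose B \<odot> y' \<prec> transpose A \<odot> y'" for x' y' j
    by (rule no_common_finite_coordinate[OF assms that(1,3,2,4)])
  show ?thesis
  proof (intro conjI iffI)
    assume "\<not> (\<exists>y\<in>Rinf_vec. transpose B \<odot> y \<prec> transpose A \<odot> y
      \<and> (\<exists>i\<in>S. \<bar>(transpose B \<odot> y) $ i\<bar> \<noteq> \<infinity>))"
    then show "\<exists>x\<in>Rinf_vec. A \<odot> x \<le> B \<odot> x \<and> (\<forall>i\<in>S. \<bar>x $ i\<bar> \<noteq> \<infinity>)"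
      using xy by metis
  next
    assume "\<not> (\<exists>y\<in>Rinf_vec. transpose B \<odot> y \<prec> transpose A \<odot> y
      \<and> (\<forall>i\<in>S. \<bar>(transpose B \<odot> y) $ i\<bar> \<noteq> \<infinity>))"
    then show "\<exists>x\<in>Rinf_vec. A \<odot> x \<le> B \<odot> x \<and> (\<exists>i\<in>S. \<bar>x $ i\<bar> \<noteq> \<infinity>)"
      using xy by metis
  qed (use excl in metis)+
qed

end
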